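(* Let $D\subsetneq\mathbb{R}^n$ be an open set with $\partial D\neq\emptyset$ and let $c\ge 2$ be a constant. For any $x\in D$ and $r\in(0,1)$, $$B_{h_{D,c}}(x,R_1)\subset B_{\tilde c}(x,r)\subset B_{h_{D,c}}(x,R_2),$$ where $R_1=\log(1+cr)$ and $R_2=\log\left(1+\frac{cr}{1-r}\right)$. Moreover, $R_2/R_1\to 1$ as $r\to 0$.
   Context: $d(x)=d(x,\partial D)$ is the Euclidean distance from $x$ to the boundary $\partial D$ of $D$ in $\mathbb{R}^n$. For $x,y\in D$: $\tilde c_D(x,y)=\sup_{p\in\partial D}\frac{|x-y|}{\max\{|x-p|,|y-p|\}}$ (the tilde-$c$ here is a name, unrelated to the constant $c$), and $h_{D,c}(x,y)=\log\left(1+c\frac{|x-y|}{\sqrt{d(x)d(y)}}\right)$. Metric balls: $B_{\tilde c}(x,r)=\{y\in D:\tilde c_D(x,y)<r\}$ and $B_{h_{D,c}}(x,R)=\{y\in D:h_{D,c}(x,y)<R\}$. *)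

theory Defs
  imports "HOL-Analysis.Analysis"
begin

definition bdist :: "(real ^ 'n) set \<Rightarrow> real ^ 'n \<Rightarrow> real" where
  "bdist D x = infdist x (frontier D)"

(* For D open with nonempty frontier and x, y in D, all denominators are positive
   and the family is bounded above by 2 (triangle inequality), so the supremum taken
   in the reals is the genuine one. *)
definition c_tilde :: "(real ^ 'n) set \<Rightarrow> real ^ 'n \<Rightarrow> real ^ 'n \<Rightarrow> real" where
  "c_tilde D x y = (SUP p\<in>frontier D. dist x y / max (dist x p) (dist y p))"

definition h_metric :: "(real ^ 'n) set \<Rightarrow> real \<Rightarrow> real ^ 'n \<Rightarrow> real ^ 'n \<Rightarrow> real" where
  "h_metric D c x y = ln (1 + c * (dist x y / sqrt (bdist D x * bdist D y)))"

definition ball_c_tilde :: "(real ^ 'n) set \<Rightarrow> real ^ 'n \<Rightarrow> real \<Rightarrow> (real ^ 'n) set" where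
  "ball_c_tilde D x r = {y \<in> D. c_tilde D x y < r}"

definition ball_h :: "(real ^ 'n) set \<Rightarrow> real \<Rightarrow> real ^ 'n \<Rightarrow> real \<Rightarrow> (real ^ 'n) set" where
  "ball_h D c x R = {y \<in> D. h_metric D c x y < R}"

definition R1 :: "real \<Rightarrow> real \<Rightarrow> real" where
  "R1 c r = ln (1 + c * r)"

definition R2 :: "real \<Rightarrow> real \<Rightarrow> real" where
  "R2 c r = ln (1 + c * r / (1 - r))"

end

theory Submission
  imports Defs "HOL-Real_Asymp.Real_Asymp"
begin

text \<open>
  Every \<open>p\<close> in the boundary satisfies \<open>max |x - p| |y - p| \<ge> max d(x) d(y) \<ge> sqrt (d(x) d(y))\<close>, which
  bounds the \<open>c\<close>-tilde quantity by \<open>|x - y| / sqrt (d(x) d(y))\<close> and gives the first inclusion. For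
  the second one, choosing for \<open>p\<close> a boundary point nearest to \<open>x\<close> gives
  \<open>|x - y| < r max d(x) |y - p| \<le> r (d(x) + |x - y|)\<close>, that is, \<open>|x - y| < r d(x) / (1 - r)\<close>; multiply
  this by the same bound with \<open>x\<close> and \<open>y\<close> exchanged.
\<close>

lemma bdist_pos:
  assumes "open D" "frontier D \<noteq> {}" "x \<in> D"
  shows "bdist D x > 0"
proof -
  have "x \<notin> frontier D"
    using assms(1,3) by (simp add: frontier_def interior_open)
  then show ?thesis
    unfolding bdist_def using infdist_pos_not_in_closed[OF frontier_closed assms(2)] by simp
qed

lemma bdist_le: "p \<in> frontier D \<Longrightarrow> bdist D x \<le> dist x p"
  unfolding bdist_def by (rule infdist_le)

lemma c_tilde_sym: "c_tilde D x y = c_tilde D y x"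
  unfolding c_tilde_def by (simp add: dist_commute max.commute)

lemma sqrt_mult_le_max:
  fixes a b :: real
  assumes "0 \<le> a" "0 \<le> b"
  shows "sqrt (a * b) \<le> max a b"
proof (rule real_le_lsqrt)
  show "a * b \<le> (max a b)\<^sup>2"
    unfolding power2_eq_square using assms by (intro mult_mono) auto
qed (use assms in auto)

text \<open>The right-hand side does not depend on \<open>p\<close>, so it bounds the supremum and
  also shows that the family is bounded above.\<close>

lemma c_tilde_term_le:
  assumes "open D" "frontier D \<noteq> {}" "x \<in> D" "y \<in> D" "p \<in> frontier D"
  shows "dist x y / max (dist x p) (dist y p) \<le> dist x y / sqrt (bdist D x * bdist D y)"
proof -
  have pos: "bdist D x > 0" "bdist D y > 0"
    by (rule bdist_pos[OF assms(1,2)], rule assms)+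
  have "sqrt (bdist D x * bdist D y) \<le> max (bdist D x) (bdist D y)"
    using pos by (intro sqrt_mult_le_max) auto
  also have "\<dots> \<le> max (dist x p) (dist y p)"
    by (intro max.mono bdist_le assms(5))
  finally show ?thesis
    using pos by - (rule frac_le, simp_all)
qed

lemma c_tilde_le:
  assumes "open D" "frontier D \<noteq> {}" "x \<in> D" "y \<in> D"
  shows "c_tilde D x y \<le> dist x y / sqrt (bdist D x * bdist D y)"
  unfolding c_tilde_def using assms by (intro cSUP_least c_tilde_term_le)

lemma dist_less_bdist:
  assumes "open D" "frontier D \<noteq> {}" "x \<in> D" "y \<in> D" "0 < r" "r < 1" "c_tilde D x y < r"
  shows "dist x y < r / (1 - r) * bdist D x"
proof -
  obtain p where p: "p \<in> frontier D" "bdist D x = dist x p"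
    unfolding bdist_def using infdist_attains_inf[OF frontier_closed assms(2)] by blast
  have pos: "dist x p > 0"
    using bdist_pos[OF assms(1-3)] p(2) by simp
  \<comment> \<open>A real supremum is only known to dominate its members once the family is bounded
    above; this justifies the comparison at the nearest point \<open>p\<close>.\<close>
  have "bdd_above ((\<lambda>p. dist x y / max (dist x p) (dist y p)) ` frontier D)"
    using c_tilde_term_le[OF assms(1-4)] by (intro bdd_aboveI2)
  then have "dist x y / max (dist x p) (dist y p) \<le> c_tilde D x y"
    unfolding c_tilde_def by (intro cSUP_upper p(1))
  then have "dist x y / max (dist x p) (dist y p) < r"
    using assms(7) by simp
  then have "dist x y < r * max (dist x p) (dist y p)"
    using pos by (simp add: pos_divide_less_eq less_max_iff_disj)
  also have "\<dots> \<le> r * (dist x p + dist x y)"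
    using assms(5) dist_triangle[of y p x] by (intro mult_left_mono) (auto simp: dist_commute)
  \<comment> \<open>Collecting the terms in \<open>dist x y\<close> leaves the factor
    \<open>1 - r\<close>, which is positive.\<close>
  finally show ?thesis
    using assms(6) p(2) by (simp add: field_simps)
qed

lemma dist_less_sqrt_bdist:
  assumes "open D" "frontier D \<noteq> {}" "x \<in> D" "y \<in> D" "0 < r" "r < 1" "c_tilde D x y < r"
  shows "dist x y / sqrt (bdist D x * bdist D y) < r / (1 - r)"
proof -
  define s where "s = r / (1 - r)"
  have s: "s > 0"
    using assms by (simp add: s_def)
  have pos: "bdist D x > 0" "bdist D y > 0"
    by (rule bdist_pos[OF assms(1,2)], rule assms)+
  have "dist x y < s * bdist D x"
    unfolding s_def by (rule dist_less_bdist[OF assms])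
  moreover have "dist x y < s * bdist D y"
    unfolding s_def dist_commute[of x y]
    by (rule dist_less_bdist) (use assms c_tilde_sym[of D x y] in simp_all)
  ultimately have "(dist x y)\<^sup>2 < (s * bdist D x) * (s * bdist D y)"
    unfolding power2_eq_square by (rule mult_strict_mono') simp_all
  also have "\<dots> = (s * sqrt (bdist D x * bdist D y))\<^sup>2"
    using pos by (simp add: power_mult_distrib power2_eq_square)
  finally have "dist x y < s * sqrt (bdist D x * bdist D y)"
    by (rule power_less_imp_less_base) (use s pos in simp)
  then show ?thesis
    using pos by (simp add: s_def pos_divide_less_eq)
qed

text \<open>Since \<open>ln\<close> and multiplication by \<open>c\<close> are strictly increasing,
  membership in an \<open>h\<close>-ball reduces to a bound on one quotient. The radii
  \<open>R1\<close> and \<open>R2\<close> arise from \<open>t = r\<close> and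
  \<open>t = r / (1 - r)\<close>.\<close>

lemma h_metric_less_iff:
  assumes "open D" "frontier D \<noteq> {}" "x \<in> D" "y \<in> D" "c > 0" "t > 0"
  shows "h_metric D c x y < ln (1 + c * t) \<longleftrightarrow> dist x y / sqrt (bdist D x * bdist D y) < t"
proof -
  have "bdist D x > 0" "bdist D y > 0"
    by (rule bdist_pos[OF assms(1,2)], rule assms)+
  then have "c * (dist x y / sqrt (bdist D x * bdist D y)) \<ge> 0" "c * t > 0"
    using assms by simp_all
  then have "h_metric D c x y < ln (1 + c * t) \<longleftrightarrow>
      c * (dist x y / sqrt (bdist D x * bdist D y)) < c * t"
    unfolding h_metric_def by (subst ln_less_cancel_iff) linarith+
  then show ?thesis
    using assms(5) by (simp only: mult_less_cancel_left_pos)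
qed

text \<open>Both logarithms are asymptotic to \<open>c * r\<close> as \<open>r\<close> tends to 0
  from the right.\<close>

lemma R2_div_R1_tendsto:
  assumes "c > 0"
  shows "((\<lambda>r. R2 c r / R1 c r) \<longlongrightarrow> 1) (at_right 0)"
  unfolding R1_def R2_def using assms by real_asymp

theorem theorem7:
  fixes D :: "(real ^ 'n) set" and c :: real
  assumes "open D" and "D \<subset> UNIV" and "frontier D \<noteq> {}" and "c \<ge> 2"
  shows "(\<forall>x\<in>D. \<forall>r\<in>{0<..<1}.
            ball_h D c x (R1 c r) \<subseteq> ball_c_tilde D x r
          \<and> ball_c_tilde D x r \<subseteq> ball_h D c x (R2 c r))
       \<and> ((\<lambda>r. R2 c r / R1 c r) \<longlongrightarrow> 1) (at_right 0)"
proof (intro conjI ballI)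
  fix x and r :: real
  assume x: "x \<in> D" and "r \<in> {0<..<1}"
  then have r: "0 < r" "r < 1"
    by auto
  have c: "c > 0"
    using assms(4) by simp
  show "ball_h D c x (R1 c r) \<subseteq> ball_c_tilde D x r"
    unfolding ball_h_def ball_c_tilde_def R1_def
    using h_metric_less_iff[OF assms(1,3) x _ c r(1)] le_less_trans[OF c_tilde_le[OF assms(1,3) x]]
    by auto
  show "ball_c_tilde D x r \<subseteq> ball_h D c x (R2 c r)"
    \<comment> \<open>Regrouping \<open>c * r / (1 - r)\<close> as \<open>c * (r / (1 - r))\<close>
      brings the radius into the form \<open>ln (1 + c * t)\<close>.\<close>
    unfolding ball_h_def ball_c_tilde_def R2_def times_divide_eq_right[symmetric]
    using h_metric_less_iff[OF assms(1,3) x _ c, of _ "r / (1 - r)"]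
      dist_less_sqrt_bdist[OF assms(1,3) x _ r] r
    by auto
qed (rule R2_div_R1_tendsto, use assms(4) in simp)

end
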